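(* Let $\Bbbk$ be an infinite field, let $n, s, d_1, \ldots, d_s$ be fixed positive integers, and let $\preceq$ be the lexicographic order on the monomials of $S=\Bbbk[x_1,\ldots,x_n]$ with $x_1 \succeq \cdots \succeq x_n$. If there exists $\mathbf{a} \in U$ such that $\operatorname{in}_{\preceq}(I_{\mathbf{a}})$ is a lexsegment ideal, then the initial ideal with respect to $\preceq$ of $V$-generic ideals (that is, the common monomial ideal $\operatorname{in}_{\preceq}(I_{\mathbf{b}})$, $\mathbf{b} \in V$) is a lexsegment ideal.
   Context: Parametrization. $S = \Bbbk[x_1,\ldots,x_n] = \bigoplus_{d\ge 0} S_d$ is graded with $\deg x_i = 1$. Let $r_i = \binom{n+d_i-1}{d_i}$ be the number of monomials of degree $d_i$ in $S$, and $N = \sum_{i=1}^s r_i$. A point $\mathbf{a} = (a_{j,k})_{1\le j\le s,\,1\le k\le r_j} \in \mathbb{A}_{\Bbbk}^N = \Bbbk^N$ corresponds to the homogeneous ideal $I_{\mathbf{a}} = (f_1,\ldots,f_s) \subset S$, where $f_j$ is the linear combination, with coefficients $a_{j,1},\ldots,a_{j,r_j}$, of all monomials of degree $d_j$ (in a fixed enumeration). The set $U$. For each $d \ge 0$ let $t_d = \max_{\mathbf{a}} \dim_{\Bbbk} (I_{\mathbf{a}})_d$ (maximum over all $\mathbf{a}\in\mathbb{A}_{\Bbbk}^N$), let $U_d = \{\mathbf{a} : \dim_{\Bbbk}(I_{\mathbf{a}})_d = t_d\}$, and let $U = \bigcap_{d\ge 0} U_d$. It is known that $U$ is a Zariski open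 dense subset of $\mathbb{A}_{\Bbbk}^N$. The set $V$ (depending on $\preceq$). For an ideal $I$, $\operatorname{in}_{\preceq}(I)$ is the ideal spanned over $\Bbbk$ by the initial terms $\operatorname{in}_{\preceq}(f)$, $f \in I$. For each $d$, a standard exterior monomial is an element $m_1\wedge\cdots\wedge m_{t_d}$ of $\bigwedge^{t_d} S_d$ with $m_1 \succ \cdots \succ m_{t_d}$ monomials of degree $d$; these are ordered lexicographically: $m_1\wedge\cdots\wedge m_{t_d} \ge m_1'\wedge\cdots\wedge m_{t_d}'$ iff they are equal or $m_i \succeq m_i'$ for the smallest $i$ with $m_i\ne m_i'$. For $\mathbf{a}\in U_d$, the monomials in $\operatorname{in}_{\preceq}(I_{\mathbf{a}})_d$ form one standard exterior monomial, which spans $\bigwedge^{t_d}\operatorname{in}_{\preceq}(I_{\mathbf{a}})_d$; let $m^{(d)}$ be the largest one obtained as $\mathbf{a}$ ranges over $U_d$. Let $V_d\subset U_d$ be the set of $\mathbf{a} \in U_d$ for which this standard exterior monomial equals $m^{(d)}$, and let $V = \bigcap_{d\ge0} V_d$. It is known that $V \subset U$ is a Zariski open dense subset of $\mathbb{A}_{\Bbbk}^N$; by construction $\operatorname{in}_{\preceq}(I_{\mathbf{a}})$ is the same for all $\mathbf{a}\in V$. The ideals $I_{\mathbf{a}}$ with $\mathbf{a}\in V$ are called $V$-generic ideals. Lexsegment. A monomial ideal $J\subset S$ is a lexsegment ideal if, for all monomials $m\in J$, every monomial $m'$ with $\deg(m')=\deg(m)$ and $m\preceq m'$ in the lexicographic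 order also belongs to $J$. *)

theory Defs
  imports Complex_Main "HOL-Library.Poly_Mapping" "HOL-Library.List_Lexorder" "HOL-Library.FuncSet"
begin

text \<open>The variables are \<open>x\<^sub>1, \<dots>, x\<^sub>n\<close>; a monomial is identified with its exponent vector.
  The order \<open>\<le>\<close> that \<^theory>\<open>HOL-Library.Poly_Mapping\<close> puts on exponent vectors compares them at the
  least index where they differ, so it is the lexicographic order with
  \<open>x\<^sub>1 > \<dots> > x\<^sub>n\<close>.\<close>

type_synonym expo = "nat \<Rightarrow>\<^sub>0 nat"
type_synonym 'k mpoly = "expo \<Rightarrow>\<^sub>0 'k"

lemma expo_less_iff:
  "u < v \<longleftrightarrow> (\<exists>i. Poly_Mapping.lookup u i < Poly_Mapping.lookup v i \<and> (\<forall>j<i. Poly_Mapping.lookup u j = Poly_Mapping.lookup v j))" for u v :: expo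
  by (simp add: less_poly_mapping.rep_eq less_fun_def)

lemma var_less: "i < j \<Longrightarrow> Poly_Mapping.single j 1 < (Poly_Mapping.single i 1 :: expo)"
  unfolding expo_less_iff by (rule exI[of _ i]) (auto simp: lookup_single)

definition expo_deg :: "expo \<Rightarrow> nat" where
  "expo_deg m = (\<Sum>i\<in>Poly_Mapping.keys m. Poly_Mapping.lookup m i)"

definition expos :: "nat \<Rightarrow> expo set" where
  "expos n = {m. Poly_Mapping.keys m \<subseteq> {1..n}}"

definition expos_deg :: "nat \<Rightarrow> nat \<Rightarrow> expo set" where
  "expos_deg n d = {m \<in> expos n. expo_deg m = d}"

abbreviation mon :: "expo \<Rightarrow> 'k::field mpoly" where
  "mon m \<equiv> Poly_Mapping.single m 1"

definition poly_ring :: "nat \<Rightarrow> 'k::field mpoly set" where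
  "poly_ring n = {p. Poly_Mapping.keys p \<subseteq> expos n}"

definition poly_ring_deg :: "nat \<Rightarrow> nat \<Rightarrow> 'k::field mpoly set" where
  "poly_ring_deg n d = {p. Poly_Mapping.keys p \<subseteq> expos_deg n d}"

definition scalar :: "'k::field \<Rightarrow> 'k mpoly \<Rightarrow> 'k mpoly" where
  "scalar c p = Poly_Mapping.single 0 c * p"

interpretation mpoly: vector_space "scalar :: 'k::field \<Rightarrow> 'k mpoly \<Rightarrow> 'k mpoly"
  by standard
    (simp_all add: scalar_def distrib_left distrib_right single_add mult_single flip: mult.assoc)

definition gen_ideal :: "nat \<Rightarrow> 'k::field mpoly set \<Rightarrow> 'k mpoly set" where
  "gen_ideal n F =
    {\<Sum>f\<in>A. g f * f | A g. finite A \<and> A \<subseteq> F \<and> (\<forall>f\<in>A. g f \<in> poly_ring n)}"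

definition monomial_ideal :: "nat \<Rightarrow> 'k::field mpoly set \<Rightarrow> bool" where
  "monomial_ideal n J \<longleftrightarrow> (\<exists>M \<subseteq> expos n. J = gen_ideal n (mon ` M))"

definition lexsegment_ideal :: "nat \<Rightarrow> 'k::field mpoly set \<Rightarrow> bool" where
  "lexsegment_ideal n J \<longleftrightarrow> monomial_ideal n J \<and>
    (\<forall>m \<in> expos n. \<forall>m' \<in> expos n.
      mon m \<in> J \<and> expo_deg m' = expo_deg m \<and> m \<le> m' \<longrightarrow> mon m' \<in> J)"

definition initial_term :: "'k::field mpoly \<Rightarrow> 'k mpoly" where
  "initial_term f = (if f = 0 then 0 else
    (let m = Max (Poly_Mapping.keys f) in Poly_Mapping.single m (Poly_Mapping.lookup f m)))"

definition initial_ideal :: "'k::field mpoly set \<Rightarrow> 'k mpoly set" where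
  "initial_ideal I = mpoly.span (initial_term ` I)"

definition num_monomials :: "nat \<Rightarrow> nat \<Rightarrow> nat" where
  "num_monomials n d = (n + d - 1) choose d"

text \<open>The affine space of all families \<open>a j k\<close> with \<open>1 \<le> j \<le> s\<close> and
  \<open>1 \<le> k \<le> r\<^sub>j\<close>.\<close>

definition params :: "nat \<Rightarrow> nat \<Rightarrow> (nat \<Rightarrow> nat) \<Rightarrow> (nat \<Rightarrow> nat \<Rightarrow> 'k::field) set" where
  "params n s d = (\<Pi>\<^sub>E j\<in>{1..s}. \<Pi>\<^sub>E k\<in>{1..num_monomials n (d j)}. UNIV)"

text \<open>In the following, \<open>e j 1, e j 2, \<dots>\<close> is the chosen enumeration of the monomials of
  degree \<open>d j\<close>.\<close>

definition enumerations :: "nat \<Rightarrow> nat \<Rightarrow> (nat \<Rightarrow> nat) \<Rightarrow> (nat \<Rightarrow> nat \<Rightarrow> expo) \<Rightarrow> bool" where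
  "enumerations n s d e \<longleftrightarrow>
    (\<forall>j\<in>{1..s}. bij_betw (e j) {1..num_monomials n (d j)} (expos_deg n (d j)))"

definition generator ::
  "nat \<Rightarrow> (nat \<Rightarrow> nat) \<Rightarrow> (nat \<Rightarrow> nat \<Rightarrow> expo) \<Rightarrow> (nat \<Rightarrow> nat \<Rightarrow> 'k::field) \<Rightarrow> nat \<Rightarrow> 'k mpoly"
  where "generator n d e a j =
    (\<Sum>k\<in>{1..num_monomials n (d j)}. scalar (a j k) (mon (e j k)))"

definition param_ideal ::
  "nat \<Rightarrow> nat \<Rightarrow> (nat \<Rightarrow> nat) \<Rightarrow> (nat \<Rightarrow> nat \<Rightarrow> expo) \<Rightarrow> (nat \<Rightarrow> nat \<Rightarrow> 'k::field) \<Rightarrow> 'k mpoly set"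
  where "param_ideal n s d e a = gen_ideal n (generator n d e a ` {1..s})"

definition hdim ::
  "nat \<Rightarrow> nat \<Rightarrow> (nat \<Rightarrow> nat) \<Rightarrow> (nat \<Rightarrow> nat \<Rightarrow> expo) \<Rightarrow> nat \<Rightarrow> (nat \<Rightarrow> nat \<Rightarrow> 'k::field) \<Rightarrow> nat"
  where "hdim n s d e \<delta> a = mpoly.dim (param_ideal n s d e a \<inter> poly_ring_deg n \<delta>)"

definition U_deg ::
  "nat \<Rightarrow> nat \<Rightarrow> (nat \<Rightarrow> nat) \<Rightarrow> (nat \<Rightarrow> nat \<Rightarrow> expo) \<Rightarrow> nat \<Rightarrow> (nat \<Rightarrow> nat \<Rightarrow> 'k::field) set"
  where "U_deg n s d e \<delta> =
    {a \<in> params n s d. hdim n s d e \<delta> a =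
      Max (hdim n s d e \<delta> ` (params n s d :: (nat \<Rightarrow> nat \<Rightarrow> 'k) set))}"

definition U_set ::
  "nat \<Rightarrow> nat \<Rightarrow> (nat \<Rightarrow> nat) \<Rightarrow> (nat \<Rightarrow> nat \<Rightarrow> expo) \<Rightarrow> (nat \<Rightarrow> nat \<Rightarrow> 'k::field) set"
  where "U_set n s d e = (\<Inter>\<delta>. U_deg n s d e \<delta>)"

text \<open>A standard exterior monomial \<open>m\<^sub>1 \<and> \<dots> \<and> m\<^sub>t\<close>, where \<open>m\<^sub>1 > \<dots> > m\<^sub>t\<close>, is
  represented by the strictly decreasing list of its factors.  The order on lists from
  \<^theory>\<open>HOL-Library.List_Lexorder\<close> is then the lexicographic order on standard exterior
  monomials.\<close>

lemma ext_less_iff: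
  fixes u v :: "expo list"
  assumes "length u = length v"
  shows "u < v \<longleftrightarrow> (\<exists>i<length u. take i u = take i v \<and> u ! i < v ! i)"
  using assms by (simp add: list_less_def lexord_take_index_conv)

definition ext_monomial ::
  "nat \<Rightarrow> nat \<Rightarrow> (nat \<Rightarrow> nat) \<Rightarrow> (nat \<Rightarrow> nat \<Rightarrow> expo) \<Rightarrow> nat \<Rightarrow> (nat \<Rightarrow> nat \<Rightarrow> 'k::field) \<Rightarrow> expo list"
  where "ext_monomial n s d e \<delta> a =
    rev (sorted_list_of_set {m \<in> expos_deg n \<delta>. mon m \<in> initial_ideal (param_ideal n s d e a)})"

definition V_deg ::
  "nat \<Rightarrow> nat \<Rightarrow> (nat \<Rightarrow> nat) \<Rightarrow> (nat \<Rightarrow> nat \<Rightarrow> expo) \<Rightarrow> nat \<Rightarrow> (nat \<Rightarrow> nat \<Rightarrow> 'k::field) set"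
  where "V_deg n s d e \<delta> =
    {a \<in> U_deg n s d e \<delta>. ext_monomial n s d e \<delta> a =
      Max (ext_monomial n s d e \<delta> ` (U_deg n s d e \<delta> :: (nat \<Rightarrow> nat \<Rightarrow> 'k) set))}"

definition V_set ::
  "nat \<Rightarrow> nat \<Rightarrow> (nat \<Rightarrow> nat) \<Rightarrow> (nat \<Rightarrow> nat \<Rightarrow> expo) \<Rightarrow> (nat \<Rightarrow> nat \<Rightarrow> 'k::field) set"
  where "V_set n s d e = (\<Inter>\<delta>. V_deg n s d e \<delta>)"

end

theory Submission imports Defs begin

text \<open>Fix a degree \<open>\<delta>\<close>.  Leading monomials count dimensions, so for all \<open>a \<in> U\<close> the set of degree
  \<open>\<delta>\<close> monomials in the initial ideal has the same cardinality.  If this set is upward closed for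
  some \<open>a\<close>, then its standard exterior monomial is the largest one possible for that
  cardinality, so by maximality it coincides with the one attained on \<open>V\<close>.\<close>

section \<open>Coefficients, supports and spans of monomials\<close>

lemma lookup_scalar: "Poly_Mapping.lookup (scalar c p) m = c * Poly_Mapping.lookup p m"
  unfolding scalar_def mult_map_scale_conv_mult[symmetric]
  by (simp add: Poly_Mapping.map.rep_eq when_def)

lemma keys_scalar_subset: "Poly_Mapping.keys (scalar c p) \<subseteq> Poly_Mapping.keys p"
  by (auto simp: in_keys_iff lookup_scalar)

lemma scalar_mon: "scalar c (mon m) = Poly_Mapping.single m c"
  by (simp add: scalar_def mult_single)

lemma mult_scalar_right: "p * scalar c q = scalar c (p * q)"
  by (simp add: scalar_def mult.left_commute)

lemma mpoly_expansion: "p = (\<Sum>m\<in>Poly_Mapping.keys p. scalar (Poly_Mapping.lookup p m) (mon m))"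
proof (rule poly_mapping_eqI)
  fix k
  show "Poly_Mapping.lookup p k =
      Poly_Mapping.lookup (\<Sum>m\<in>Poly_Mapping.keys p. scalar (Poly_Mapping.lookup p m) (mon m)) k"
    by (auto simp: lookup_sum scalar_mon lookup_single when_def in_keys_iff)
qed

lemma lookup_mon_mult: "Poly_Mapping.lookup (mon m * p) (m + k) = Poly_Mapping.lookup p k"
  for p :: "'k::field mpoly"
proof -
  have "mon m * p = mon m * (\<Sum>l\<in>Poly_Mapping.keys p. scalar (Poly_Mapping.lookup p l) (mon l))"
    using mpoly_expansion[of p] by simp
  also have "\<dots> = (\<Sum>l\<in>Poly_Mapping.keys p. Poly_Mapping.single (m + l) (Poly_Mapping.lookup p l))"
    by (simp add: sum_distrib_left scalar_mon mult_single)
  finally show ?thesis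
    by (auto simp: lookup_sum lookup_single when_def in_keys_iff)
qed

text \<open>In general \<open>keys_mult\<close> only bounds the support of a product. With a
  monomial factor the support is shifted injectively, so nothing can cancel and equality
  holds.\<close>

lemma keys_mon_mult: "Poly_Mapping.keys (mon m * p) = (+) m ` Poly_Mapping.keys p"
  for p :: "'k::field mpoly"
proof
  show "Poly_Mapping.keys (mon m * p) \<subseteq> (+) m ` Poly_Mapping.keys p"
    using keys_mult[of "mon m" p] by auto
qed (auto simp: in_keys_iff lookup_mon_mult)

lemma subspace_keys_subset: "mpoly.subspace {p. Poly_Mapping.keys p \<subseteq> X}"
proof (rule mpoly.subspaceI)
  fix p q :: "'a mpoly" and c
  assume p: "p \<in> {p. Poly_Mapping.keys p \<subseteq> X}"
  show "scalar c p \<in> {p. Poly_Mapping.keys p \<subseteq> X}"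
    using p keys_scalar_subset[of c p] by auto
  assume "q \<in> {p. Poly_Mapping.keys p \<subseteq> X}"
  with p show "p + q \<in> {p. Poly_Mapping.keys p \<subseteq> X}"
    using keys_add[of p q] by auto
qed auto

lemma span_mon: "mpoly.span (mon ` X :: 'k::field mpoly set) = {p. Poly_Mapping.keys p \<subseteq> X}"
proof
  show "mpoly.span (mon ` X :: 'k mpoly set) \<subseteq> {p. Poly_Mapping.keys p \<subseteq> X}"
    by (rule mpoly.span_minimal[OF _ subspace_keys_subset]) auto
  show "{p. Poly_Mapping.keys p \<subseteq> X} \<subseteq> mpoly.span (mon ` X :: 'k mpoly set)"
  proof
    fix p :: "'k mpoly" assume "p \<in> {p. Poly_Mapping.keys p \<subseteq> X}"
    then have "(\<Sum>m\<in>Poly_Mapping.keys p. scalar (Poly_Mapping.lookup p m) (mon m)) \<in> mpoly.span (mon ` X)"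
      by (intro mpoly.span_sum mpoly.span_scale mpoly.span_base) auto
    then show "p \<in> mpoly.span (mon ` X)"
      using mpoly_expansion[of p] by simp
  qed
qed

section \<open>Exponent vectors and their degrees\<close>

lemma expo_deg_add: "expo_deg (u + v) = expo_deg u + expo_deg v"
proof -
  let ?S = "Poly_Mapping.keys u \<union> Poly_Mapping.keys v"
  have *: "expo_deg w = (\<Sum>i\<in>?S. Poly_Mapping.lookup w i)" if "Poly_Mapping.keys w \<subseteq> ?S" for w
    unfolding expo_deg_def using that by (intro sum.mono_neutral_left) (auto simp: in_keys_iff)
  show ?thesis
    using keys_add[of u v] by (simp add: * lookup_add sum.distrib)
qed

lemma expos_add: "u \<in> expos n \<Longrightarrow> v \<in> expos n \<Longrightarrow> u + v \<in> expos n"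
  using keys_add[of u v] by (auto simp: expos_def)

lemma zero_in_expos: "0 \<in> expos n"
  by (simp add: expos_def)

text \<open>No single exponent exceeds the total degree, so \<open>lookup\<close> injects these
  vectors into the functions that are bounded by \<delta> and vanish outside the variable
  indices.\<close>

lemma finite_expos_deg: "finite (expos_deg n \<delta>)"
proof (rule finite_imageD[where f = Poly_Mapping.lookup])
  let ?F = "{f. \<forall>i. (i \<in> {1..n} \<longrightarrow> f i \<in> {..\<delta>}) \<and> (i \<notin> {1..n} \<longrightarrow> f i = (0::nat))}"
  have "Poly_Mapping.lookup m \<in> ?F" if "m \<in> expos_deg n \<delta>" for m
  proof -
    have "Poly_Mapping.lookup m i \<le> \<delta>" for i
    proof (cases "i \<in> Poly_Mapping.keys m")
      case True
      then show ?thesis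
        using that member_le_sum[of i "Poly_Mapping.keys m" "Poly_Mapping.lookup m"]
        by (auto simp: expos_deg_def expo_deg_def)
    qed (simp add: in_keys_iff)
    moreover have "Poly_Mapping.lookup m i = 0" if "i \<notin> {1..n}" for i
      using \<open>m \<in> expos_deg n \<delta>\<close> that by (auto simp: expos_deg_def expos_def in_keys_iff)
    ultimately show ?thesis by auto
  qed
  moreover have "finite ?F"
    by (rule finite_set_of_finite_funs) auto
  ultimately show "finite (Poly_Mapping.lookup ` expos_deg n \<delta>)"
    by (rule finite_subset[OF image_subsetI])
qed (auto simp: inj_on_def)

section \<open>Leading exponents, initial ideals and dimension\<close>

text \<open>Recording exponents instead of initial terms discards the leading coefficients. The zero
  polynomial is excluded because \<open>Max\<close> of its empty support has no meaning.\<close>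

definition lead_expos :: "'k::field mpoly set \<Rightarrow> expo set" where
  "lead_expos W = {Max (Poly_Mapping.keys f) | f. f \<in> W \<and> f \<noteq> 0}"

lemma Max_keys_in_keys: "f \<noteq> 0 \<Longrightarrow> Max (Poly_Mapping.keys f) \<in> Poly_Mapping.keys f" for f :: "'k::field mpoly"
proof (rule Max_in)
  assume "f \<noteq> 0"
  then obtain m where "Poly_Mapping.lookup f m \<noteq> 0"
    by (metis lookup_zero poly_mapping_eqI)
  then show "Poly_Mapping.keys f \<noteq> {}"
    by (auto simp: in_keys_iff)
qed simp

text \<open>Over a field an initial term is a nonzero multiple of its leading monomial, so initial
  terms and leading monomials have the same span. By \<open>span_mon\<close> this span is described
  by supports alone.\<close>

lemma initial_ideal_eq:
  assumes W: "mpoly.subspace W"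
  shows "initial_ideal W = {p. Poly_Mapping.keys p \<subseteq> lead_expos W}"
proof -
  have "initial_term ` W \<subseteq> mpoly.span (mon ` lead_expos W)"
    by (auto simp: initial_term_def Let_def span_mon lead_expos_def split: if_splits)
  moreover have "mon ` lead_expos W \<subseteq> mpoly.span (initial_term ` W)"
  proof
    fix p :: "'a mpoly" assume "p \<in> mon ` lead_expos W"
    then obtain f where f: "f \<in> W" "f \<noteq> 0" and p: "p = mon (Max (Poly_Mapping.keys f))"
      by (auto simp: lead_expos_def)
    let ?c = "Poly_Mapping.lookup f (Max (Poly_Mapping.keys f))"
    have "?c \<noteq> 0"
      using Max_keys_in_keys[OF f(2)] by (simp add: in_keys_iff)
    then have "p = scalar (1 / ?c) (initial_term f)"
      using f by (simp add: p initial_term_def Let_def scalar_def mult_single)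
    then show "p \<in> mpoly.span (initial_term ` W)"
      using f by (auto intro: mpoly.span_scale mpoly.span_base)
  qed
  ultimately show ?thesis
    unfolding initial_ideal_def span_mon[symmetric]
    by (intro equalityI mpoly.span_minimal mpoly.subspace_span)
qed

lemma mon_in_initial_ideal_iff:
  assumes "mpoly.subspace W"
  shows "mon m \<in> initial_ideal W \<longleftrightarrow> m \<in> lead_expos W"
  using assms by (simp add: initial_ideal_eq)

text \<open>Picking one element of \<open>W\<close> for each leading exponent gives a triangular
  family. It is independent because its leading exponents are distinct, and it spans by successive
  cancellation of leading terms, as in Gaussian elimination.\<close>

lemma dim_eq_card_lead_expos:
  assumes W: "mpoly.subspace W" and E: "finite E" "W \<subseteq> {p. Poly_Mapping.keys p \<subseteq> E}"
  shows "mpoly.dim W = card (lead_expos W)"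
proof -
  have "\<forall>m\<in>lead_expos W. \<exists>f. f \<in> W \<and> f \<noteq> 0 \<and> Max (Poly_Mapping.keys f) = m"
    by (auto simp: lead_expos_def)
  then obtain g where
    g: "\<And>m. m \<in> lead_expos W \<Longrightarrow> g m \<in> W \<and> g m \<noteq> 0 \<and> Max (Poly_Mapping.keys (g m)) = m"
    by metis
  have "lead_expos W \<subseteq> E"
    using E Max_keys_in_keys by (fastforce simp: lead_expos_def)
  then have fin: "finite (lead_expos W)"
    using E(1) finite_subset by blast
  have inj: "inj_on g (lead_expos W)"
    by (metis g inj_onI)
  have top: "Poly_Mapping.lookup (g m) m \<noteq> 0" if "m \<in> lead_expos W" for m
    using Max_keys_in_keys[of "g m"] g[OF that] by (simp add: in_keys_iff)
  have above: "Poly_Mapping.lookup (g m) k = 0" if "m \<in> lead_expos W" "m < k" for m k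
    using g[OF that(1)] that(2) Max_ge[of "Poly_Mapping.keys (g m)" k]
    by (force simp: in_keys_iff)
  have "mpoly.independent (g ` lead_expos W)"
  proof
    assume "mpoly.dependent (g ` lead_expos W)"
    then obtain u where u: "\<exists>v\<in>g ` lead_expos W. u v \<noteq> 0"
      "(\<Sum>v\<in>g ` lead_expos W. scalar (u v) v) = 0"
      using fin by (auto simp: mpoly.dependent_finite)
    \<comment> \<open>Take the largest leading exponent \<open>m\<close> that occurs in the
      relation. At \<open>m\<close>, members with smaller leading exponent have coefficient 0, and
      those with larger one do not occur, so only the nonzero contribution of \<open>g m\<close> is
      left.\<close>
    let ?X = "{m \<in> lead_expos W. u (g m) \<noteq> 0}"
    define m where "m = Max ?X"
    have X: "finite ?X" "?X \<noteq> {}" using u fin by auto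
    then have m: "m \<in> ?X" unfolding m_def by (rule Max_in)
    have "(\<Sum>k\<in>lead_expos W. u (g k) * Poly_Mapping.lookup (g k) m) =
        (\<Sum>k\<in>lead_expos W. if k = m then u (g m) * Poly_Mapping.lookup (g m) m else 0)"
    proof (rule sum.cong)
      fix k assume k: "k \<in> lead_expos W"
      show "u (g k) * Poly_Mapping.lookup (g k) m =
          (if k = m then u (g m) * Poly_Mapping.lookup (g m) m else 0)"
      proof (cases k m rule: linorder_cases)
        case greater
        then have "k \<notin> ?X" using X Max_ge[of ?X k] by (auto simp: m_def)
        with k greater show ?thesis by auto
      qed (use above[OF k] in auto)
    qed simp
    moreover have "(\<Sum>k\<in>lead_expos W. u (g k) * Poly_Mapping.lookup (g k) m) =
        Poly_Mapping.lookup (\<Sum>v\<in>g ` lead_expos W. scalar (u v) v) m"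
      using inj by (simp add: sum.reindex lookup_sum lookup_scalar)
    ultimately show False
      using u(2) m top[of m] fin by simp
  qed
  \<comment> \<open>The induction measure counts the elements of the finite set \<open>E\<close>
    that lie below the support of \<open>f\<close>. Cancelling the leading term removes at least the
    old leading exponent from this set, so no appeal to well-foundedness of the monomial order is
    made.\<close>
  moreover have "f \<in> mpoly.span (g ` lead_expos W)" if "f \<in> W" for f
    using that
  proof (induction "card {x \<in> E. \<exists>y\<in>Poly_Mapping.keys f. x \<le> y}" arbitrary: f rule: less_induct)
    case less
    show ?case
    proof (cases "f = 0")
      case True
      then show ?thesis by (simp add: mpoly.span_zero)
    next
      case False
      define m where "m = Max (Poly_Mapping.keys f)"
      \<comment> \<open>The quotient of the leading coefficients, so that subtracting
        \<open>scalar c (g m)\<close> kills the coefficient at \<open>m\<close>.\<close>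
      define c where "c = Poly_Mapping.lookup f m / Poly_Mapping.lookup (g m) m"
      define h where "h = f - scalar c (g m)"
      have m: "m \<in> lead_expos W" and mk: "m \<in> Poly_Mapping.keys f"
        using less.prems False Max_keys_in_keys[of f] by (auto simp: lead_expos_def m_def)
      have h: "h \<in> W"
        using less.prems W g[OF m] by (simp add: h_def mpoly.subspace_diff mpoly.subspace_scale)
      have hm: "Poly_Mapping.lookup h m = 0"
        using top[OF m] by (simp add: h_def c_def lookup_minus lookup_scalar)
      have lt: "k < m" if "k \<in> Poly_Mapping.keys h" for k
      proof (rule ccontr)
        assume "\<not> k < m"
        with that hm have "m < k" by (cases k m rule: linorder_cases) (auto simp: in_keys_iff)
        moreover from this have "k \<notin> Poly_Mapping.keys f"
          by (metis finite_keys Max_ge leD m_def)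
        ultimately show False
          using that above[OF m] by (simp add: h_def in_keys_iff lookup_minus lookup_scalar)
      qed
      have "m \<in> {x \<in> E. \<exists>y\<in>Poly_Mapping.keys f. x \<le> y}"
        using mk E(2) less.prems by auto
      moreover have "m \<notin> {x \<in> E. \<exists>y\<in>Poly_Mapping.keys h. x \<le> y}"
        using lt by force
      moreover have "{x \<in> E. \<exists>y\<in>Poly_Mapping.keys h. x \<le> y} \<subseteq> {x \<in> E. \<exists>y\<in>Poly_Mapping.keys f. x \<le> y}"
        using lt mk by (blast intro: order_trans less_imp_le)
      ultimately have "{x \<in> E. \<exists>y\<in>Poly_Mapping.keys h. x \<le> y} \<subset> {x \<in> E. \<exists>y\<in>Poly_Mapping.keys f. x \<le> y}"
        by blast
      then have "h \<in> mpoly.span (g ` lead_expos W)"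
        by (intro less.hyps[OF _ h] psubset_card_mono) (simp add: E(1))
      then have "h + scalar c (g m) \<in> mpoly.span (g ` lead_expos W)"
        by (rule mpoly.span_add) (use m in \<open>auto intro: mpoly.span_scale mpoly.span_base\<close>)
      then show ?thesis by (simp add: h_def)
    qed
  qed
  ultimately have "card (g ` lead_expos W) = mpoly.dim W"
    using g by (intro mpoly.basis_card_eq_dim) auto
  then show ?thesis
    using inj by (simp add: card_image)
qed

section \<open>Generated ideals as spans of monomial multiples\<close>

text \<open>Expanding the polynomial coefficients into monomials turns ideal membership into linear
  algebra, so that later closure properties follow by induction over a span.\<close>

lemma gen_ideal_eq_span:
  "gen_ideal n F = mpoly.span {mon m * f | m f. m \<in> expos n \<and> f \<in> F}" (is "_ = mpoly.span ?G")
proof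
  show "gen_ideal n F \<subseteq> mpoly.span ?G"
  proof
    fix p assume "p \<in> gen_ideal n F"
    then obtain A g where A: "A \<subseteq> F" "\<And>f. f \<in> A \<Longrightarrow> g f \<in> poly_ring n"
      and p: "p = (\<Sum>f\<in>A. g f * f)"
      by (auto simp: gen_ideal_def)
    have "g f * f \<in> mpoly.span ?G" if f: "f \<in> A" for f
    proof -
      have "g f * f = (\<Sum>m\<in>Poly_Mapping.keys (g f). scalar (Poly_Mapping.lookup (g f) m) (mon m)) * f"
        using mpoly_expansion[of "g f"] by simp
      also have "\<dots> = (\<Sum>m\<in>Poly_Mapping.keys (g f). scalar (Poly_Mapping.lookup (g f) m) (mon m * f))"
        by (simp add: sum_distrib_right scalar_def mult.assoc)
      also have "\<dots> \<in> mpoly.span ?G"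
        using A f by (intro mpoly.span_sum mpoly.span_scale mpoly.span_base) (force simp: poly_ring_def)
      finally show ?thesis .
    qed
    then show "p \<in> mpoly.span ?G"
      unfolding p by (rule mpoly.span_sum)
  qed
  show "mpoly.span ?G \<subseteq> gen_ideal n F"
  proof
    fix p assume "p \<in> mpoly.span ?G"
    then show "p \<in> gen_ideal n F"
    proof (induction rule: mpoly.span_induct_alt)
      case base
      show ?case by (force simp: gen_ideal_def intro: exI[of _ "{}"])
    next
      case (step c x y)
      then obtain m f A g where mf: "m \<in> expos n" "f \<in> F" "x = mon m * f"
        and A: "finite A" "A \<subseteq> F" "\<forall>f\<in>A. g f \<in> poly_ring n" "y = (\<Sum>f\<in>A. g f * f)"
        by (auto simp: gen_ideal_def)
      \<comment> \<open>The values of \<open>g\<close> outside \<open>A\<close> are arbitrary.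
        Resetting them to 0 lets the new term be added at \<open>f\<close> whether or not
        \<open>f\<close> already belongs to \<open>A\<close>.\<close>
      define g' where "g' k = (if k \<in> A then g k else 0)" for k
      define h where "h k = g' k + (if k = f then scalar c (mon m) else 0)" for k
      have y: "y = (\<Sum>k\<in>insert f A. g' k * k)"
        unfolding A(4) using A(1) by (intro sum.mono_neutral_cong_left) (auto simp: g'_def)
      have x: "scalar c x = (\<Sum>k\<in>insert f A. (if k = f then scalar c (mon m) else 0) * k)"
      proof -
        have "(\<Sum>k\<in>insert f A. (if k = f then scalar c (mon m) else 0) * k) =
            (\<Sum>k\<in>insert f A. if k = f then scalar c (mon m) * f else 0)"
          by (intro sum.cong) auto
        then show ?thesis
          using A(1) by (simp add: mf scalar_def mult.assoc)
      qed
      have "scalar c x + y = (\<Sum>k\<in>insert f A. h k * k)"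
        by (simp only: x y h_def distrib_right sum.distrib add.commute)
      moreover have "h k \<in> poly_ring n" if "k \<in> insert f A" for k
      proof -
        have "mpoly.subspace (poly_ring n :: 'a mpoly set)"
          unfolding poly_ring_def by (rule subspace_keys_subset)
        moreover have "mon m \<in> poly_ring n" "g' k \<in> poly_ring n"
          using mf A by (auto simp: poly_ring_def g'_def)
        ultimately show ?thesis
          by (auto simp: h_def intro: mpoly.subspace_add mpoly.subspace_scale)
      qed
      ultimately show ?case
        using A mf unfolding gen_ideal_def by (intro CollectI exI[of _ "insert f A"] exI[of _ h]) auto
    qed
  qed
qed

lemma subspace_gen_ideal: "mpoly.subspace (gen_ideal n F)"
  by (simp add: gen_ideal_eq_span)

lemma mon_mult_gen_ideal:
  assumes "f \<in> gen_ideal n F" "m \<in> expos n"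
  shows "mon m * f \<in> gen_ideal n F"
  using assms(1) unfolding gen_ideal_eq_span
proof (induction rule: mpoly.span_induct_alt)
  case base
  then show ?case by (simp add: mpoly.span_zero)
next
  case (step c x y)
  then obtain m' f where "m' \<in> expos n" "f \<in> F" and x: "x = mon m' * f" by auto
  moreover have "mon m * x = mon (m + m') * f"
    by (simp add: x mult_single flip: mult.assoc)
  ultimately have "mon m * x \<in> mpoly.span {mon m * f | m f. m \<in> expos n \<and> f \<in> F}"
    using assms(2) expos_add by (intro mpoly.span_base) blast
  with step.IH show ?case
    by (simp add: distrib_left mult_scalar_right mpoly.span_add mpoly.span_scale)
qed

lemma gen_ideal_subset_poly_ring:
  assumes "F \<subseteq> poly_ring n"
  shows "gen_ideal n F \<subseteq> poly_ring n"
  unfolding gen_ideal_eq_span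
proof (rule mpoly.span_minimal)
  show "mpoly.subspace (poly_ring n :: 'a mpoly set)"
    unfolding poly_ring_def by (rule subspace_keys_subset)
  show "{mon m * f | m f. m \<in> expos n \<and> f \<in> F} \<subseteq> poly_ring n"
    using assms expos_add by (fastforce simp: poly_ring_def keys_mon_mult)
qed

text \<open>The order on exponents is monotone under translation, so multiplying by a monomial moves
  the largest exponent along with the whole support.\<close>

lemma lead_expos_gen_ideal_add:
  assumes "l \<in> lead_expos (gen_ideal n F)" "m \<in> expos n"
  shows "m + l \<in> lead_expos (gen_ideal n F)"
proof -
  obtain f where f: "f \<in> gen_ideal n F" "f \<noteq> 0" "l = Max (Poly_Mapping.keys f)"
    using assms(1) by (auto simp: lead_expos_def)
  have ne: "Poly_Mapping.keys f \<noteq> {}"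
    using Max_keys_in_keys[OF f(2)] by auto
  have "mono ((+) m)"
    by (simp add: mono_def add_left_mono)
  then have "Max (Poly_Mapping.keys (mon m * f)) = m + l"
    using mono_Max_commute[of "(+) m" "Poly_Mapping.keys f"] ne f(3) by (simp add: keys_mon_mult)
  moreover have "mon m * f \<noteq> 0"
    using ne keys_mon_mult[of m f] by auto
  ultimately show ?thesis
    using mon_mult_gen_ideal[OF f(1) assms(2)] unfolding lead_expos_def by force
qed

lemma lead_expos_subset_expos:
  assumes "W \<subseteq> poly_ring n"
  shows "lead_expos W \<subseteq> expos n"
proof
  fix m assume "m \<in> lead_expos W"
  then obtain f where "f \<in> W" "f \<noteq> 0" "m = Max (Poly_Mapping.keys f)"
    by (auto simp: lead_expos_def)
  then show "m \<in> expos n"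
    using assms Max_keys_in_keys[of f] unfolding poly_ring_def by blast
qed

text \<open>The leading exponents are closed under adding exponents of monomials in the ring. Hence
  the ideal generated by the leading monomials is no larger than their linear span, which is the
  initial ideal.\<close>

lemma monomial_ideal_initial_ideal:
  assumes "F \<subseteq> poly_ring n"
  shows "monomial_ideal n (initial_ideal (gen_ideal n F))"
proof -
  let ?L = "lead_expos (gen_ideal n F)"
  have "{mon m * f | m f. m \<in> expos n \<and> f \<in> mon ` ?L} = (mon ` ?L :: 'a mpoly set)"
  proof
    show "{mon m * f | m f. m \<in> expos n \<and> f \<in> mon ` ?L} \<subseteq> (mon ` ?L :: 'a mpoly set)"
      by (auto simp: mult_single lead_expos_gen_ideal_add)
    show "(mon ` ?L :: 'a mpoly set) \<subseteq> {mon m * f | m f. m \<in> expos n \<and> f \<in> mon ` ?L}"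
    proof
      fix p :: "'a mpoly" assume "p \<in> mon ` ?L"
      then show "p \<in> {mon m * f | m f. m \<in> expos n \<and> f \<in> mon ` ?L}"
        \<comment> \<open>The exponent 0 stands for the factor 1.\<close>
        using zero_in_expos by (intro CollectI exI[of _ 0] exI[of _ p]) auto
    qed
  qed
  then have "initial_ideal (gen_ideal n F) = gen_ideal n (mon ` ?L)"
    by (simp add: gen_ideal_eq_span[of n "mon ` ?L"] span_mon initial_ideal_eq subspace_gen_ideal)
  then show ?thesis
    using lead_expos_subset_expos[OF gen_ideal_subset_poly_ring[OF assms]]
    by (auto simp: monomial_ideal_def)
qed

section \<open>Homogeneous components\<close>

definition hom_part :: "nat \<Rightarrow> 'k::field mpoly \<Rightarrow> 'k mpoly" where
  "hom_part \<delta> p = (\<Sum>m\<in>{m \<in> Poly_Mapping.keys p. expo_deg m = \<delta>}. scalar (Poly_Mapping.lookup p m) (mon m))"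

lemma lookup_hom_part:
  "Poly_Mapping.lookup (hom_part \<delta> p) m = (if expo_deg m = \<delta> then Poly_Mapping.lookup p m else 0)"
  by (auto simp: hom_part_def lookup_sum scalar_mon lookup_single when_def in_keys_iff)

lemma keys_hom_part: "Poly_Mapping.keys (hom_part \<delta> p) = {m \<in> Poly_Mapping.keys p. expo_deg m = \<delta>}"
  by (auto simp: in_keys_iff lookup_hom_part split: if_splits)

text \<open>Taking the component of degree \<delta> is linear, and it either fixes or annihilates a
  monomial multiple of a homogeneous generator. The span description of the ideal then gives the
  claim.\<close>

lemma hom_part_in_gen_ideal:
  assumes hom: "\<And>f. f \<in> F \<Longrightarrow> \<exists>k. \<forall>m\<in>Poly_Mapping.keys f. expo_deg m = k"
    and "p \<in> gen_ideal n F"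
  shows "hom_part \<delta> p \<in> gen_ideal n F"
  using assms(2) unfolding gen_ideal_eq_span
proof (induction rule: mpoly.span_induct_alt)
  case base
  have "hom_part \<delta> 0 = (0 :: 'a mpoly)"
    by (simp add: hom_part_def)
  then show ?case by (simp add: mpoly.span_zero)
next
  case (step c x y)
  let ?G = "{mon m * f | m f. m \<in> expos n \<and> f \<in> F}"
  obtain m f where f: "m \<in> expos n" "f \<in> F" and x: "x = mon m * f"
    using step by auto
  obtain k where k: "\<forall>m\<in>Poly_Mapping.keys f. expo_deg m = k"
    using hom f by blast
  then have "\<forall>l\<in>Poly_Mapping.keys x. expo_deg l = expo_deg m + k"
    by (auto simp: x keys_mon_mult expo_deg_add)
  then have "hom_part \<delta> x = (if \<delta> = expo_deg m + k then x else 0)"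
    by (intro poly_mapping_eqI) (auto simp: lookup_hom_part in_keys_iff)
  then have "hom_part \<delta> x \<in> mpoly.span ?G"
    using step.hyps by (auto intro: mpoly.span_base mpoly.span_zero)
  moreover have "hom_part \<delta> (scalar c x + y) = scalar c (hom_part \<delta> x) + hom_part \<delta> y"
    by (intro poly_mapping_eqI) (auto simp: lookup_hom_part lookup_add lookup_scalar)
  ultimately show ?case
    using step.IH by (simp add: mpoly.span_add mpoly.span_scale)
qed

text \<open>The order does not compare degrees first, so a polynomial with leading exponent of
  degree \<delta> may have terms of other degrees. Passing to its component of degree \<delta> keeps
  the leading term and only shrinks the support, so the maximum is unchanged.\<close>

lemma lead_expos_poly_ring_deg:
  assumes hom: "\<And>f. f \<in> F \<Longrightarrow> \<exists>k. \<forall>m\<in>Poly_Mapping.keys f. expo_deg m = k"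
    and "F \<subseteq> poly_ring n"
  shows "lead_expos (gen_ideal n F \<inter> poly_ring_deg n \<delta>) = lead_expos (gen_ideal n F) \<inter> expos_deg n \<delta>"
proof
  show "lead_expos (gen_ideal n F \<inter> poly_ring_deg n \<delta>) \<subseteq> lead_expos (gen_ideal n F) \<inter> expos_deg n \<delta>"
    using Max_keys_in_keys by (fastforce simp: lead_expos_def poly_ring_deg_def)
  show "lead_expos (gen_ideal n F) \<inter> expos_deg n \<delta> \<subseteq> lead_expos (gen_ideal n F \<inter> poly_ring_deg n \<delta>)"
  proof
    fix m assume m: "m \<in> lead_expos (gen_ideal n F) \<inter> expos_deg n \<delta>"
    then obtain f where f: "f \<in> gen_ideal n F" "f \<noteq> 0" "m = Max (Poly_Mapping.keys f)"
      by (auto simp: lead_expos_def)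
    have m': "m \<in> Poly_Mapping.keys (hom_part \<delta> f)"
      using f m Max_keys_in_keys[OF f(2)] by (auto simp: keys_hom_part expos_deg_def)
    have "Max (Poly_Mapping.keys (hom_part \<delta> f)) = m"
      using m' by (intro Max_eqI) (auto simp: keys_hom_part f(3))
    moreover have "hom_part \<delta> f \<in> poly_ring_deg n \<delta>"
      using gen_ideal_subset_poly_ring[OF assms(2)] f(1)
      by (auto simp: poly_ring_deg_def poly_ring_def keys_hom_part expos_deg_def)
    moreover have "hom_part \<delta> f \<noteq> 0" using m' by auto
    ultimately show "m \<in> lead_expos (gen_ideal n F \<inter> poly_ring_deg n \<delta>)"
      using hom_part_in_gen_ideal[OF hom f(1), of \<delta>] unfolding lead_expos_def by blast
  qed
qed

section \<open>Maximality of upward closed sets among sets of equal size\<close>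

text \<open>At the first difference the list of \<open>B\<close> would have the larger entry. Upward
  closure puts this entry into \<open>A\<close>, and since the list of \<open>A\<close> decreases,
  it occurs there at an earlier position. The lists agree up to that point, so the list of
  \<open>B\<close> would contain the entry twice.\<close>

lemma upper_set_eq_if_rev_sorted_le:
  fixes A B E :: "'a::linorder set"
  assumes fin: "finite E" and sub: "A \<subseteq> E" "B \<subseteq> E" and card: "card A = card B"
    and upper: "\<And>x y. x \<in> A \<Longrightarrow> y \<in> E \<Longrightarrow> x \<le> y \<Longrightarrow> y \<in> A"
    and le: "rev (sorted_list_of_set A) \<le> rev (sorted_list_of_set B)"
  shows "A = B"
proof (rule ccontr)
  assume "A \<noteq> B"
  define xs ys where "xs = rev (sorted_list_of_set A)" and "ys = rev (sorted_list_of_set B)"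
  have AB: "finite A" "finite B" using fin sub finite_subset by auto
  have set: "set xs = A" "set ys = B" and dist: "distinct xs" "distinct ys"
    and len: "length xs = length ys"
    using AB card by (simp_all add: xs_def ys_def)
  have dec: "sorted_wrt (>) xs"
    using AB by (simp add: xs_def sorted_wrt_rev)
  have "xs < ys"
    using le set \<open>A \<noteq> B\<close> unfolding xs_def[symmetric] ys_def[symmetric] by (metis order_le_less)
  \<comment> \<open>Equal lengths rule out that \<open>xs\<close> is a proper prefix of
    \<open>ys\<close>, so there is a genuine first position of difference.\<close>
  then obtain i where i: "i < length xs" "take i xs = take i ys" "xs ! i < ys ! i"
    using len by (auto simp: list_less_def lexord_take_index_conv)
  have "ys ! i \<in> A"
  proof (rule upper)
    show "xs ! i \<in> A" using i set by auto
    show "ys ! i \<in> E" using i len set sub nth_mem[of i ys] by auto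
  qed (use i in simp)
  then obtain j where j: "j < length xs" "xs ! j = ys ! i"
    using set by (metis in_set_conv_nth)
  have "j < i"
  proof (rule ccontr)
    assume "\<not> j < i"
    then have "xs ! j \<le> xs ! i"
      using dec i(1) j(1) by (cases "i = j") (auto simp: sorted_wrt_iff_nth_less less_imp_le)
    with i(3) j(2) show False by simp
  qed
  then have "xs ! j = ys ! j"
    using i(2) by (metis nth_take)
  then show False
    using j i(1) len \<open>j < i\<close> dist(2) by (simp add: nth_eq_iff_index_eq)
qed

section \<open>Comparison of the ideals of two parameters\<close>

lemma generator_keys:
  assumes "enumerations n s d e" "j \<in> {1..s}"
  shows "Poly_Mapping.keys (generator n d e a j) \<subseteq> expos_deg n (d j)"
proof -
  have "bij_betw (e j) {1..num_monomials n (d j)} (expos_deg n (d j))"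
    using assms unfolding enumerations_def by blast
  then have "\<And>k. k \<in> {1..num_monomials n (d j)} \<Longrightarrow> e j k \<in> expos_deg n (d j)"
    by (rule bij_betwE[THEN bspec])
  then have "generator n d e a j \<in> mpoly.span (mon ` expos_deg n (d j))"
    unfolding generator_def by (intro mpoly.span_sum mpoly.span_scale mpoly.span_base imageI)
  then show ?thesis by (simp add: span_mon)
qed

theorem theorem3p5:
  fixes n s :: nat
    and d :: "nat \<Rightarrow> nat"
    and e :: "nat \<Rightarrow> nat \<Rightarrow> expo"
  assumes "infinite (UNIV :: 'k::field set)"
    and "n \<ge> 1" and "s \<ge> 1" and "\<forall>j\<in>{1..s}. d j \<ge> 1"
    and "enumerations n s d e"
    and "\<exists>a \<in> (U_set n s d e :: (nat \<Rightarrow> nat \<Rightarrow> 'k) set).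
           lexsegment_ideal n (initial_ideal (param_ideal n s d e a))"
  shows "\<forall>b \<in> (V_set n s d e :: (nat \<Rightarrow> nat \<Rightarrow> 'k) set).
           lexsegment_ideal n (initial_ideal (param_ideal n s d e b))"
proof
  fix b :: "nat \<Rightarrow> nat \<Rightarrow> 'k"
  assume b: "b \<in> V_set n s d e"
  obtain a :: "nat \<Rightarrow> nat \<Rightarrow> 'k" where a: "a \<in> U_set n s d e"
    and lex: "lexsegment_ideal n (initial_ideal (param_ideal n s d e a))"
    using assms(6) by blast
  \<comment> \<open>The degree \<delta> slice of the initial ideal; \<open>ext_monomial\<close>
    lists it in decreasing order.\<close>
  define M where "M \<delta> c = {m \<in> expos_deg n \<delta>. mon m \<in> initial_ideal (param_ideal n s d e c)}"
    for \<delta> and c :: "nat \<Rightarrow> nat \<Rightarrow> 'k"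
  have ring: "generator n d e c ` {1..s} \<subseteq> poly_ring n" for c :: "nat \<Rightarrow> nat \<Rightarrow> 'k"
    using generator_keys[OF assms(5)] by (fastforce simp: poly_ring_def expos_deg_def)
  have hom: "\<exists>k. \<forall>m\<in>Poly_Mapping.keys f. expo_deg m = k"
    if "f \<in> generator n d e c ` {1..s}" for f and c :: "nat \<Rightarrow> nat \<Rightarrow> 'k"
    using that generator_keys[OF assms(5)] by (fastforce simp: expos_deg_def)
  \<comment> \<open>In degree \<delta> the monomials of the initial ideal are exactly the leading
    exponents of the graded piece of the ideal, and these count its dimension.\<close>
  have card_M: "card (M \<delta> c) = hdim n s d e \<delta> c" for \<delta> c
  proof -
    let ?I = "param_ideal n s d e c" and ?S = "poly_ring_deg n \<delta> :: 'k mpoly set"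
    have "mpoly.subspace ?I" "mpoly.subspace ?S"
      unfolding param_ideal_def poly_ring_deg_def
      by (rule subspace_gen_ideal subspace_keys_subset)+
    then have "mpoly.dim (?I \<inter> ?S) = card (lead_expos (?I \<inter> ?S))"
      by (intro dim_eq_card_lead_expos[OF _ finite_expos_deg[of n \<delta>]] mpoly.subspace_inter)
        (auto simp: poly_ring_deg_def)
    moreover have "lead_expos (?I \<inter> ?S) = M \<delta> c"
      unfolding M_def mon_in_initial_ideal_iff[OF \<open>mpoly.subspace ?I\<close>]
      using lead_expos_poly_ring_deg[OF hom ring] by (auto simp: param_ideal_def)
    ultimately show ?thesis by (simp add: hdim_def)
  qed
  have M_eq: "M \<delta> a = M \<delta> b" for \<delta>
  proof (rule upper_set_eq_if_rev_sorted_le[OF finite_expos_deg[of n \<delta>]])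
    have aU: "a \<in> U_deg n s d e \<delta>" and bV: "b \<in> V_deg n s d e \<delta>"
      using a b by (auto simp: U_set_def V_set_def)
    \<comment> \<open>Both dimensions equal the same \<open>Max\<close> expression, since
      \<open>V_deg\<close> lies inside \<open>U_deg\<close>.\<close>
    then show "card (M \<delta> a) = card (M \<delta> b)"
      by (simp add: card_M V_deg_def U_deg_def)
    show "M \<delta> a \<subseteq> expos_deg n \<delta>" "M \<delta> b \<subseteq> expos_deg n \<delta>"
      by (auto simp: M_def)
    show "y \<in> M \<delta> a" if "x \<in> M \<delta> a" "y \<in> expos_deg n \<delta>" "x \<le> y" for x y
      using that lex by (auto simp: M_def lexsegment_ideal_def expos_deg_def)
    have ext: "ext_monomial n s d e \<delta> c = rev (sorted_list_of_set (M \<delta> c))" for c :: "nat \<Rightarrow> nat \<Rightarrow> 'k"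
      by (simp add: ext_monomial_def M_def)
    \<comment> \<open>\<open>Max\<close> bounds its elements only for a finite set. The parameters
      range over an infinite field, but the lists come from subsets of the finite set
      \<open>expos_deg n \<delta>\<close>.\<close>
    have "ext_monomial n s d e \<delta> ` (U_deg n s d e \<delta> :: (nat \<Rightarrow> nat \<Rightarrow> 'k) set)
        \<subseteq> (\<lambda>X. rev (sorted_list_of_set X)) ` Pow (expos_deg n \<delta>)"
      by (auto simp: ext M_def)
    then have "finite (ext_monomial n s d e \<delta> ` (U_deg n s d e \<delta> :: (nat \<Rightarrow> nat \<Rightarrow> 'k) set))"
      by (rule finite_subset) (simp add: finite_expos_deg)
    then have "ext_monomial n s d e \<delta> a \<le> ext_monomial n s d e \<delta> b"
      using aU bV by (auto simp: V_deg_def)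
    then show "rev (sorted_list_of_set (M \<delta> a)) \<le> rev (sorted_list_of_set (M \<delta> b))"
      by (simp add: ext)
  qed
  \<comment> \<open>The exchange condition for lexsegment ideals speaks only of monomials, so
    agreement in every degree transfers it from \<open>a\<close> to \<open>b\<close>. Being a
    monomial ideal is established separately for \<open>b\<close>.\<close>
  have "mon m \<in> initial_ideal (param_ideal n s d e b) \<longleftrightarrow> mon m \<in> initial_ideal (param_ideal n s d e a)"
    if "m \<in> expos n" for m
    using M_eq[of "expo_deg m"] that by (auto simp: M_def expos_deg_def)
  moreover have "monomial_ideal n (initial_ideal (param_ideal n s d e b))"
    unfolding param_ideal_def by (rule monomial_ideal_initial_ideal[OF ring])
  ultimately show "lexsegment_ideal n (initial_ideal (param_ideal n s d e b))"
    using lex unfolding lexsegment_ideal_def by blast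
qed

end
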